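(* Let $r,t$ be positive integers and let $E$ be an $rt\times rt$ rational matrix consisting of a $t\times t$ array of $r\times r$ blocks $C_{i,j}$ ($0\le i,j\le t-1$), each of which is a circulant matrix. Write $C_{i,j}=g_{i,j}(P)=\sum_{m=0}^{r-1}c^{(i,j)}_m P^m$, where $(c^{(i,j)}_0,\dots,c^{(i,j)}_{r-1})$ is the first column of $C_{i,j}$ and $P$ is the $r\times r$ cyclic permutation matrix with $P[k+1,k]=1$ for $0\le k\le r-2$, $P[0,r-1]=1$ and all other entries $0$. For $z\in\mathbb{C}$ let $\underline{E}(z)$ be the $t\times t$ complex matrix with entries $\underline{E}(z)[i,j]=g_{i,j}(z)$. Then $E$ is singular if and only if $\underline{E}(\omega_k)$ is singular for some positive divisor $k$ of $r$, where $\omega_k=\exp(2\pi i/k)$.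
   Context: A circulant $r\times r$ matrix with first column $(c_0,\dots,c_{r-1})$ is the matrix whose $(a,b)$ entry is $c_{(a-b)\bmod r}$; equivalently it equals $\sum_{m=0}^{r-1}c_mP^m$ with $P$ as in the claim. *)

theory Defs
  imports
    Complex_Main
    "HOL-Computational_Algebra.Polynomial"
    "Jordan_Normal_Form.Matrix"
begin

definition circulant :: "nat \<Rightarrow> (nat \<Rightarrow> 'a) \<Rightarrow> 'a mat" where
  "circulant r c = mat r r (\<lambda>(a, b). c (nat ((int a - int b) mod int r)))"

definition is_circulant :: "nat \<Rightarrow> 'a mat \<Rightarrow> bool" where
  "is_circulant r A \<longleftrightarrow> (\<exists>c. A = circulant r c)"

definition cyclic_perm_mat :: "nat \<Rightarrow> 'a :: semiring_1 mat" where
  "cyclic_perm_mat r = mat r r (\<lambda>(a, b). if a = b + 1 \<or> a = 0 \<and> b = r - 1 then 1 else 0)"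

text \<open>The polynomial whose coefficients are the entries of the first column. By the lemma
  \<open>circulant_eq_poly_cyclic_perm_mat\<close> below, a circulant matrix is the value of this
  polynomial at the cyclic permutation matrix.\<close>

definition first_col_poly :: "nat \<Rightarrow> 'a :: comm_monoid_add mat \<Rightarrow> 'a poly" where
  "first_col_poly r A = (\<Sum>m<r. monom (A $$ (m, 0)) m)"

definition mat_block :: "nat \<Rightarrow> 'a mat \<Rightarrow> nat \<Rightarrow> nat \<Rightarrow> 'a mat" where
  "mat_block r E i j = mat r r (\<lambda>(a, b). E $$ (i * r + a, j * r + b))"

definition symbol_mat :: "nat \<Rightarrow> nat \<Rightarrow> rat mat \<Rightarrow> complex \<Rightarrow> complex mat" where
  "symbol_mat r t E z =
     mat t t (\<lambda>(i, j). poly (map_poly of_rat (first_col_poly r (mat_block r E i j))) z)"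

definition singular_mat :: "'a :: semiring_1 mat \<Rightarrow> bool" where
  "singular_mat A \<longleftrightarrow> square_mat A \<and> \<not> invertible_mat A"

lemma cyclic_perm_mat_carrier [simp]: "cyclic_perm_mat r \<in> carrier_mat r r"
  by (simp add: cyclic_perm_mat_def)

lemma cyclic_perm_mat_index:
  assumes "a < r" "b < r"
  shows "cyclic_perm_mat r $$ (a, b) = (if a = (b + 1) mod r then 1 else 0)"
proof (cases "b + 1 = r")
  case True
  with assms show ?thesis by (auto simp: cyclic_perm_mat_def)
next
  case False
  with assms show ?thesis by (auto simp: cyclic_perm_mat_def)
qed

lemma cyclic_perm_mat_pow_index:
  assumes "a < r" "b < r"
  shows "((cyclic_perm_mat r :: 'a :: semiring_1 mat) ^\<^sub>m m) $$ (a, b) = (if a = (b + m) mod r then 1 else 0)"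
  using assms
proof (induction m arbitrary: a b)
  case 0
  then show ?case by (simp add: cyclic_perm_mat_def)
next
  case (Suc m)
  let ?P = "cyclic_perm_mat r :: 'a mat"
  have P: "?P ^\<^sub>m m \<in> carrier_mat r r"
    by (rule pow_carrier_mat) simp
  have "(?P ^\<^sub>m Suc m) $$ (a, b) = (\<Sum>l = 0..<r. (?P ^\<^sub>m m) $$ (a, l) * ?P $$ (l, b))"
    using Suc.prems carrier_matD[OF P] carrier_matD[OF cyclic_perm_mat_carrier[of r, where 'a = 'a]]
    by (simp add: scalar_prod_def)
  also have "\<dots> = (\<Sum>l = 0..<r. if l = (b + 1) mod r then (?P ^\<^sub>m m) $$ (a, l) else 0)"
    using Suc.prems by (intro sum.cong) (auto simp: cyclic_perm_mat_index)
  also have "\<dots> = (?P ^\<^sub>m m) $$ (a, (b + 1) mod r)"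
    using Suc.prems by (simp add: sum.delta)
  also have "\<dots> = (if a = ((b + 1) mod r + m) mod r then 1 else 0)"
    using Suc.prems by (intro Suc.IH) auto
  also have "((b + 1) mod r + m) mod r = (b + Suc m) mod r"
    by (simp add: mod_add_left_eq)
  finally show ?case .
qed

lemma circulant_eq_poly_cyclic_perm_mat:
  fixes A :: "'a :: comm_semiring_1 mat"
  assumes "is_circulant r A"
  shows "A = mat r r (\<lambda>(a, b). \<Sum>m<r. coeff (first_col_poly r A) m *
                                    (cyclic_perm_mat r ^\<^sub>m m) $$ (a, b))"
proof -
  obtain c where A: "A = circulant r c"
    using assms by (auto simp: is_circulant_def)
  have dims: "dim_row A = r" "dim_col A = r"
    by (simp_all add: A circulant_def)
  have "A $$ (a, b) = (\<Sum>m<r. coeff (first_col_poly r A) m * (cyclic_perm_mat r ^\<^sub>m m) $$ (a, b))"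
    if ab: "a < r" "b < r" for a b
  proof -
    have coeff: "coeff (first_col_poly r A) m = c m" if "m < r" for m
      using that by (simp add: first_col_poly_def coeff_sum A circulant_def)
    define d where "d = nat ((int a - int b) mod int r)"
    have d: "d < r" "int d = (int a - int b) mod int r"
      using ab by (auto simp: d_def nat_less_iff)
    have iff: "a = (b + m) mod r \<longleftrightarrow> m = d" if "m < r" for m
    proof -
      have "a = (b + m) mod r \<longleftrightarrow> int a mod int r = (int b + int m) mod int r"
        using ab by (metis mod_less of_nat_add of_nat_eq_iff of_nat_mod)
      also have "\<dots> \<longleftrightarrow> (int a - int b) mod int r = int m mod int r"
        by (simp add: mod_eq_dvd_iff algebra_simps)
      also have "\<dots> \<longleftrightarrow> m = d"
        using that d by auto
      finally show ?thesis .
    qed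
    have "(\<Sum>m<r. coeff (first_col_poly r A) m * (cyclic_perm_mat r ^\<^sub>m m) $$ (a, b))
            = (\<Sum>m<r. if m = d then c m else 0)"
      using ab by (intro sum.cong) (auto simp: coeff iff cyclic_perm_mat_pow_index)
    also have "\<dots> = c d"
      using d by simp
    also have "\<dots> = A $$ (a, b)"
      using ab by (simp add: A circulant_def d_def)
    finally show ?thesis by simp
  qed
  then show ?thesis
    by (intro eq_matI) (simp_all add: dims)
qed

end

theory Submission
  imports Defs "Jordan_Normal_Form.Char_Poly" "HOL-Number_Theory.Cong"
begin

text \<open>
  Pairing a block row index with the powers of an \<open>r\<close>-th root of unity \<open>z\<close> intertwines \<open>E\<close> with its
  symbol at \<open>z\<close>, and the \<open>r\<close> roots of unity together separate vectors; hence \<open>E\<close> is singular iff its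
  symbol is singular at some \<open>z\<close> with \<open>z\<^sup>r = 1\<close>. Such a \<open>z\<close> is \<open>\<omega>\<^sub>k\<^sup>j\<close> with \<open>k\<close> dividing \<open>r\<close> and \<open>j\<close>
  coprime to \<open>k\<close>, and the determinant of the symbol is a rational polynomial \<open>f\<close> in \<open>z\<close>, so it remains
  to pass from the root \<open>\<omega>\<^sub>k\<^sup>j\<close> of \<open>f\<close> to the conjugate root \<open>\<omega>\<^sub>k\<close>.

  Instead of the irreducibility of cyclotomic polynomials we use an argument in the style of Landau. For
  \<open>f\<close> integral and \<open>p\<close> prime, \<open>f(x\<^sup>p) = f(x)\<^sup>p\<close> modulo \<open>p\<close>, so \<open>f(\<omega>\<^sup>i) = 0\<close> makes \<open>f(\<omega>\<^sup>i\<^sup>p)\<close>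
  divisible by \<open>p\<close> in \<open>\<int>[\<omega>]\<close>. The finitely many nonzero values \<open>f(\<omega>\<^sup>i)\<close> have only finitely many
  prime divisors \<open>p\<close>, so \<open>f(\<omega>\<^sup>i\<^sup>p) = 0\<close> for all large \<open>p\<close>. Finally \<open>j\<close> has an inverse modulo \<open>k\<close> all
  of whose prime factors are large.
\<close>

subsection \<open>Conjugate roots of unity\<close>

lemma power_mod_root_of_unity:
  fixes z :: "'a :: comm_ring_1"
  assumes "z ^ k = 1"
  shows "z ^ (n mod k) = z ^ n"
proof -
  have "z ^ n = z ^ (k * (n div k) + n mod k)" by simp
  also have "\<dots> = z ^ (n mod k)" unfolding power_add power_mult assms by simp
  finally show ?thesis by simp
qed

section \<open>The Frobenius congruence modulo a prime\<close>

text \<open>All inner binomial coefficients of row p are multiples of p. The ring is kept general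
  because the congruence is applied both to integers and to integer polynomials.\<close>

lemma of_nat_prime_dvd_power_add:
  fixes x y :: "'a :: comm_ring_1"
  assumes "prime p"
  shows "of_nat p dvd (x + y) ^ p - x ^ p - y ^ p"
proof -
  have p: "p > 0" using assms by (simp add: prime_gt_0_nat)
  let ?f = "\<lambda>i. of_nat (p choose i) * x ^ i * y ^ (p - i)"
  have "{..p} = insert 0 (insert p {1..<p})"
    using p by auto
  then have "(x + y) ^ p = y ^ p + x ^ p + (\<Sum>i\<in>{1..<p}. ?f i)"
    using p by (simp add: binomial_ring algebra_simps)
  moreover have "of_nat p dvd (\<Sum>i\<in>{1..<p}. ?f i)"
  proof (intro dvd_sum dvd_mult2)
    fix i assume "i \<in> {1..<p}"
    then have "p dvd p choose i"
      using assms by (intro dvd_choose_prime) auto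
    then show "of_nat p dvd (of_nat (p choose i) :: 'a)"
      by (metis dvd_def of_nat_mult)
  qed
  ultimately show ?thesis by simp
qed

text \<open>Fermat's little theorem, which handles the constant coefficients in the next lemma.
  Adding or subtracting 1 changes a^p - a by a multiple of p, by the binomial congruence with y =
  1.\<close>

lemma prime_dvd_int_power_minus_self:
  fixes a :: int
  assumes "prime p"
  shows "int p dvd a ^ p - a"
proof (induction a rule: int_induct[where k = 0])
  case base
  show ?case using assms by (simp add: prime_gt_0_nat power_0_left)
next
  case (step1 a)
  have "(a + 1) ^ p - (a + 1) = ((a + 1) ^ p - a ^ p - 1 ^ p) + (a ^ p - a)" by simp
  then show ?case
    using step1 of_nat_prime_dvd_power_add[OF assms, of a 1] by (metis dvd_add of_nat_id)
next
  case (step2 a)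
  have "(a - 1) ^ p - (a - 1) = (a ^ p - a) - ((a - 1 + 1) ^ p - (a - 1) ^ p - 1 ^ p)" by simp
  then show ?case
    using step2 of_nat_prime_dvd_power_add[OF assms, of "a - 1" 1] by (metis dvd_diff of_nat_id)
qed

text \<open>Writing the polynomial as a + X f, the difference splits into three multiples of p: X^p
  times the induction hypothesis, Fermat's theorem for a, and the binomial congruence for a and X
  f.\<close>

lemma of_nat_prime_dvd_pcompose_monom:
  fixes f :: "int poly"
  assumes "prime p"
  shows "of_nat p dvd pcompose f (monom 1 p) - f ^ p"
proof (induction f)
  case 0
  show ?case using assms by (simp add: prime_gt_0_nat power_0_left)
next
  case (pCons a f)
  let ?g = "pcompose f (monom 1 p)"
  let ?X = "monom 1 1 :: int poly"
  have split: "pCons a f = [:a:] + ?X * f"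
    by (simp add: monom_altdef)
  have "int p dvd a ^ p - a" by (rule prime_dvd_int_power_minus_self[OF assms])
  then have "of_nat p dvd [:a ^ p - a:]"
    by (simp add: of_nat_poly const_poly_dvd_const_poly_iff)
  moreover have "[:a ^ p - a:] = [:a:] ^ p - [:a:]"
    by (simp add: poly_const_pow)
  ultimately have 1: "of_nat p dvd [:a:] ^ p - [:a:]" by simp
  have 2: "of_nat p dvd ?X ^ p * (?g - f ^ p)"
    using pCons.IH by simp
  have 3: "of_nat p dvd (pCons a f) ^ p - [:a:] ^ p - (?X * f) ^ p"
    unfolding split by (rule of_nat_prime_dvd_power_add[OF assms])
  have "pcompose (pCons a f) (monom 1 p) - pCons a f ^ p =
      ?X ^ p * (?g - f ^ p) - ([:a:] ^ p - [:a:]) - ((pCons a f) ^ p - [:a:] ^ p - (?X * f) ^ p)"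
    by (simp add: pcompose_pCons monom_power power_mult_distrib algebra_simps)
  then show ?case using 1 2 3 by (metis dvd_diff)
qed

section \<open>Integrality and divisibility in Z[\<omega>]\<close>

text \<open>Multiplication by h(\<omega>) maps the span of 1, \<omega>, ..., \<omega>^(k-1) over the
  integers to itself. So h(\<omega>) is an eigenvalue of an integer matrix and a root of its monic
  characteristic polynomial.\<close>

lemma algebraic_int_poly_root_of_unity:
  fixes \<omega> :: complex
  assumes k: "k > 0" and \<omega>: "\<omega> ^ k = 1"
  shows "algebraic_int (poly (of_int_poly h) \<omega>)"
proof -
  let ?\<beta> = "poly (of_int_poly h) \<omega> :: complex"
  \<comment> \<open>Row a expands h(\<omega>) \<omega>^a in the powers \<omega>^b, with exponents
    reduced modulo k; hence the vector of these powers is the eigenvector.\<close>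
  define A where "A = mat k k (\<lambda>(a, b). \<Sum>i\<le>degree h. if (a + i) mod k = b then coeff h i else 0)"
  define v where "v = vec k (\<lambda>b. \<omega> ^ b)"
  have A: "A \<in> carrier_mat k k" by (simp add: A_def)
  let ?A = "map_mat of_int A :: complex mat"
  have A': "?A \<in> carrier_mat k k" using A by simp
  note pw = power_mod_root_of_unity[OF \<omega>]
  have "?A *\<^sub>v v = ?\<beta> \<cdot>\<^sub>v v"
  proof (rule eq_vecI)
    fix a assume "a < dim_vec (?\<beta> \<cdot>\<^sub>v v)"
    then have a: "a < k" by (simp add: v_def)
    have "(?A *\<^sub>v v) $ a = (\<Sum>b = 0..<k. (\<Sum>i\<le>degree h. if (a + i) mod k = b then of_int (coeff h i) else 0) * \<omega> ^ b)"
      using a by (simp add: A_def v_def scalar_prod_def of_int_sum if_distrib cong: if_cong)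
    also have "\<dots> = (\<Sum>b = 0..<k. \<Sum>i\<le>degree h. if (a + i) mod k = b then of_int (coeff h i) * \<omega> ^ b else 0)"
      by (simp add: sum_distrib_right if_distrib[of "\<lambda>x. x * _"] cong: if_cong)
    also have "\<dots> = (\<Sum>i\<le>degree h. \<Sum>b = 0..<k. if (a + i) mod k = b then of_int (coeff h i) * \<omega> ^ b else 0)"
      by (rule sum.swap)
    also have "\<dots> = (\<Sum>i\<le>degree h. of_int (coeff h i) * \<omega> ^ ((a + i) mod k))"
      using k by (intro sum.cong) simp_all
    also have "\<dots> = ?\<beta> * \<omega> ^ a"
      by (simp add: pw poly_altdef sum_distrib_right sum_distrib_left power_add mult_ac)
    finally show "(?A *\<^sub>v v) $ a = (?\<beta> \<cdot>\<^sub>v v) $ a" using a by (simp add: v_def)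
  qed (use A in \<open>simp add: v_def\<close>)
  moreover have "v \<noteq> 0\<^sub>v k"
  proof
    assume "v = 0\<^sub>v k"
    then have "v $ 0 = 0\<^sub>v k $ 0" by simp
    then show False using k by (simp add: v_def)
  qed
  ultimately have "eigenvalue ?A ?\<beta>"
    using A by (auto simp: eigenvalue_def eigenvector_def v_def intro!: exI[of _ v])
  then have "poly (char_poly ?A) ?\<beta> = 0"
    by (simp add: eigenvalue_root_char_poly[OF A'])
  moreover have "char_poly ?A = of_int_poly (char_poly A)"
    by (rule of_int_hom.char_poly_hom[OF A])
  moreover have "lead_coeff (char_poly A) = 1"
    using degree_monic_char_poly[OF A] by simp
  ultimately show ?thesis
    unfolding algebraic_int_altdef_ipoly by auto
qed

text \<open>As x is nonzero, factors X of \<open>q\<close> can be cancelled until the constant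
  coefficient a is nonzero. Then q = a + X q1 and q(x) = 0 give x (-q1(x)) = a.\<close>

lemma int_multiple_of_algebraic:
  fixes x :: "'a :: field_char_0"
  assumes "q \<noteq> 0" "poly (of_int_poly q) x = 0" "x \<noteq> 0"
  shows "\<exists>N s. N \<noteq> 0 \<and> x * poly (of_int_poly s) x = of_int N"
  using assms
proof (induction q)
  case (pCons a q)
  show ?case
  proof (cases "a = 0")
    case True
    then show ?thesis using pCons by auto
  next
    case False
    have "x * poly (of_int_poly (- q)) x = of_int a"
      using pCons.prems by (simp add: of_int_poly_hom.hom_uminus add_eq_0_iff)
    then show ?thesis using False by blast
  qed
qed simp

text \<open>This replaces integrality of norms: a nonzero element of \<open>\<int>[\<omega>]\<close> divides a nonzero integer \<open>N\<close>, and
  \<open>p\<close> divides \<open>N\<close> in \<open>\<int>[\<omega>]\<close> only if it does so in \<open>\<int>\<close>.\<close>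

lemma finite_primes_dividing_root_of_unity_poly:
  fixes \<omega> :: complex
  assumes k: "k > 0" and \<omega>: "\<omega> ^ k = 1" and nz: "poly (of_int_poly g) \<omega> \<noteq> 0"
  shows "\<exists>B. \<forall>p h. p > 0 \<longrightarrow> poly (of_int_poly g) \<omega> = of_nat p * poly (of_int_poly h) \<omega> \<longrightarrow> p \<le> B"
proof -
  let ?\<alpha> = "poly (of_int_poly g) \<omega>"
  obtain q where q: "poly (of_int_poly q) ?\<alpha> = 0" "lead_coeff q = (1 :: int)"
    using algebraic_int_poly_root_of_unity[OF k \<omega>, of g] unfolding algebraic_int_altdef_ipoly by auto
  then have "q \<noteq> 0" by auto
  then obtain N s where N: "N \<noteq> 0" and s: "?\<alpha> * poly (of_int_poly s) ?\<alpha> = of_int N"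
    using int_multiple_of_algebraic[OF _ q(1) nz] by blast
  show ?thesis
  proof (intro exI[of _ "nat \<bar>N\<bar>"] allI impI)
    fix p :: nat and h assume p: "p > 0" and h: "?\<alpha> = of_nat p * poly (of_int_poly h) \<omega>"
    \<comment> \<open>This is h(\<omega>) s(\<alpha>), which equals N / p. It is rational and an
      algebraic integer, hence an integer, so p divides N.\<close>
    let ?\<gamma> = "poly (of_int_poly (h * pcompose s g)) \<omega>"
    have eq: "of_nat p * ?\<gamma> = of_int N"
      unfolding s[symmetric] using h
      by (simp add: of_int_hom.map_poly_pcompose poly_pcompose hom_distribs mult.assoc[symmetric])
    then have "?\<gamma> = of_rat (of_int N / of_nat p)"
      using p by (simp add: field_simps of_rat_divide)
    then have "?\<gamma> \<in> \<rat>" by simp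
    then have "?\<gamma> \<in> \<int>"
      using rational_algebraic_int_is_int algebraic_int_poly_root_of_unity[OF k \<omega>] by blast
    then obtain M where "?\<gamma> = of_int M" by (elim Ints_cases)
    then have "of_int (int p * M) = (of_int N :: complex)" using eq by simp
    then have "int p * M = N" by (simp only: of_int_eq_iff)
    then have "int p dvd N" by auto
    then show "p \<le> nat \<bar>N\<bar>" using N by (metis dvd_imp_le_int nat_int nat_mono abs_of_nat)
  qed
qed

section \<open>Passing from \<omega>^j to \<omega> through large primes\<close>

lemma root_of_unity_conjugate:
  fixes \<omega> :: complex and f :: "int poly"
  assumes k: "k > 0" and \<omega>: "\<omega> ^ k = 1" and j: "coprime j k"
    and root: "poly (of_int_poly f) (\<omega> ^ j) = 0"
  shows "poly (of_int_poly f) \<omega> = 0"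
proof -
  let ?F = "\<lambda>i. poly (of_int_poly f) (\<omega> ^ i) :: complex"
  note pw = power_mod_root_of_unity[OF \<omega>]
  have F: "?F i = poly (of_int_poly (pcompose f (monom 1 i))) \<omega>" for i
    by (simp add: of_int_hom.map_poly_pcompose poly_pcompose poly_monom)
  have "\<exists>B. \<forall>p h. p > 0 \<longrightarrow> ?F i \<noteq> 0 \<longrightarrow> ?F i = of_nat p * poly (of_int_poly h) \<omega> \<longrightarrow> p \<le> B" for i
    using finite_primes_dividing_root_of_unity_poly[OF k \<omega>, of "pcompose f (monom 1 i)"] F[of i] by metis
  then obtain b where b: "\<And>i p h. p > 0 \<Longrightarrow> ?F i \<noteq> 0 \<Longrightarrow> ?F i = of_nat p * poly (of_int_poly h) \<omega> \<Longrightarrow> p \<le> b i"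
    by metis
  \<comment> \<open>The value \<open>?F i\<close> depends only on i modulo k, so k bounds yield one
    that serves all exponents.\<close>
  define B where "B = Max (b ` {..<k})"
  have bB: "b (i mod k) \<le> B" for i
    unfolding B_def using k by (intro Max_ge) auto
  have step: "?F (i * p) = 0" if "?F i = 0" "prime p" "p > B" for i p
  proof (rule ccontr)
    assume "?F (i * p) \<noteq> 0"
    then have nz: "?F ((i * p) mod k) \<noteq> 0" by (unfold pw)
    obtain h where "pcompose f (monom 1 p) - f ^ p = of_nat p * h"
      using of_nat_prime_dvd_pcompose_monom[OF \<open>prime p\<close>, of f] by (elim dvdE)
    then have h: "pcompose f (monom 1 p) = f ^ p + of_nat p * h" by (simp add: algebra_simps)
    have "?F (i * p) = poly (of_int_poly (pcompose f (monom 1 p))) (\<omega> ^ i)"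
      by (simp add: of_int_hom.map_poly_pcompose poly_pcompose poly_monom power_mult)
    also have "\<dots> = ?F i ^ p + of_nat p * poly (of_int_poly h) (\<omega> ^ i)"
      unfolding h by (simp add: hom_distribs)
    also have "\<dots> = of_nat p * poly (of_int_poly (pcompose h (monom 1 i))) \<omega>"
      using that by (simp add: of_int_hom.map_poly_pcompose poly_pcompose poly_monom prime_gt_0_nat power_0_left)
    finally have "p \<le> b ((i * p) mod k)"
      using b[OF _ nz] prime_gt_0_nat[OF \<open>prime p\<close>] by (simp only: pw)
    then show False using bB[of "i * p"] \<open>p > B\<close> by linarith
  qed
  \<comment> \<open>The prime factors of m are split off one at a time, each moving the zero from
    exponent i to i p.\<close>
  have rough: "?F (i * m) = 0" if "m > 0" "?F i = 0" "\<forall>p. prime p \<longrightarrow> p dvd m \<longrightarrow> p > B" for i m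
    using that
  proof (induction m arbitrary: i rule: less_induct)
    case (less m)
    show ?case
    proof (cases "m = 1")
      case False
      then obtain p where p: "prime p" "p dvd m" using prime_factor_nat by blast
      then obtain n where n: "m = p * n" by auto
      have "?F ((i * p) * n) = 0"
      proof (rule less.IH)
        show "n < m" "n > 0" using n less.prems(1) prime_gt_1_nat[OF p(1)] by auto
        show "?F (i * p) = 0" using step less.prems p by blast
        show "\<forall>p. prime p \<longrightarrow> p dvd n \<longrightarrow> p > B" using less.prems(3) n by simp
      qed
      then show ?thesis by (simp only: n mult.assoc)
    qed (use less in simp)
  qed
  \<comment> \<open>The form \<open>1 mod k\<close> covers k = 1.\<close>
  obtain j' where j': "(j * j') mod k = 1 mod k"
    using cong_solve_coprime_nat[OF j] by (auto simp: cong_def)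
  have cop: "coprime j' k"
    using j' by (metis coprime_mult_left_iff coprime_1_left coprime_mod_left_iff k neq0_conv mult.commute)
  \<comment> \<open>An elementary substitute for Dirichlet's theorem: m is congruent to j' modulo k,
    and every prime p up to B divides exactly one of the two summands. If p divides j', it divides
    neither k nor the product; otherwise it is a factor of the product.\<close>
  define m where "m = j' + k * \<Prod>{p. prime p \<and> p \<le> B \<and> \<not> p dvd j'}"
  have fin: "finite {p. prime p \<and> p \<le> B \<and> \<not> p dvd j'}"
    by (rule finite_subset[of _ "{..B}"]) auto
  have "\<Prod>{p. prime p \<and> p \<le> B \<and> \<not> p dvd j'} > 0"
    by (intro prod_pos) (auto simp: prime_gt_0_nat)
  then have "m > 0" using k by (simp add: m_def)
  moreover have "p > B" if p: "prime p" "p dvd m" for p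
  proof (rule ccontr)
    assume "\<not> p > B"
    then have pB: "p \<le> B" by simp
    show False
    proof (cases "p dvd j'")
      case True
      then have "p dvd k * \<Prod>{p. prime p \<and> p \<le> B \<and> \<not> p dvd j'}"
        using p(2) unfolding m_def by (metis dvd_add_right_iff)
      then consider "p dvd k" | "p dvd \<Prod>{p. prime p \<and> p \<le> B \<and> \<not> p dvd j'}"
        using p(1) by (auto simp: prime_dvd_mult_iff)
      then show False
      proof cases
        case 1
        then show False using cop True p(1) by (metis coprime_common_divisor_nat not_prime_1)
      next
        case 2
        then obtain q where "prime q" "\<not> q dvd j'" "p dvd q"
          using prime_dvd_prod_iff[OF fin p(1)] by auto
        then show False using True p(1) primes_dvd_imp_eq by blast
      qed
    next
      case False
      then have "p \<in> {p. prime p \<and> p \<le> B \<and> \<not> p dvd j'}" using p(1) pB by simp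
      then have "p dvd \<Prod>{p. prime p \<and> p \<le> B \<and> \<not> p dvd j'}"
        using dvd_prodI[OF fin, of p "\<lambda>x. x"] by simp
      then have "p dvd j'" using p(2) unfolding m_def by (metis dvd_mult dvd_add_left_iff)
      then show False using False by simp
    qed
  qed
  ultimately have "?F (j * m) = 0" using rough root by blast
  moreover have "\<omega> ^ (j * m) = \<omega>"
  proof -
    have "(j * m) mod k = (j * j') mod k"
      by (simp add: m_def distrib_left mult.left_commute[of j k])
    then have "\<omega> ^ (j * m) = \<omega> ^ 1" using pw[of "j * m"] pw[of 1] j' by simp
    then show ?thesis by simp
  qed
  ultimately show ?thesis by simp
qed

lemma rat_poly_int_multiple:
  fixes f :: "rat poly"
  shows "\<exists>d g. d \<noteq> 0 \<and> Polynomial.smult (of_int d) f = of_int_poly g"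
proof (induction f)
  case 0
  show ?case by (intro exI[of _ 1] exI[of _ 0]) simp
next
  case (pCons a f)
  obtain d g where d: "d \<noteq> 0" "Polynomial.smult (of_int d) f = of_int_poly g" using pCons.IH by blast
  obtain m n where a: "a = of_int m / of_int n" "n \<noteq> 0"
    by (cases a) (auto simp: Fract_of_int_quotient)
  have na: "of_int (n * d) * a = of_int (d * m)"
    unfolding a(1) using a(2) by simp
  have "Polynomial.smult (of_int (n * d)) (pCons a f) =
      pCons (of_int (d * m)) (Polynomial.smult (of_int n) (Polynomial.smult (of_int d) f))"
    using na by (simp only: smult_pCons smult_smult of_int_mult)
  also have "\<dots> = of_int_poly (pCons (d * m) (Polynomial.smult n g))"
    unfolding d(2) by (simp add: of_int_hom.map_poly_pCons_hom of_int_hom.map_poly_hom_smult)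
  finally have "Polynomial.smult (of_int (n * d)) (pCons a f) = of_int_poly (pCons (d * m) (Polynomial.smult n g))" .
  moreover have "n * d \<noteq> 0" using a(2) d(1) by simp
  ultimately show ?case by blast
qed

lemma root_of_unity_conjugate_rat:
  fixes \<omega> :: complex and f :: "rat poly"
  assumes "k > 0" "\<omega> ^ k = 1" "coprime j k" "poly (map_poly of_rat f) (\<omega> ^ j) = 0"
  shows "poly (map_poly of_rat f) \<omega> = 0"
proof -
  obtain d g where d: "d \<noteq> 0" "Polynomial.smult (of_int d) f = of_int_poly g" using rat_poly_int_multiple by blast
  have "map_poly of_rat (Polynomial.smult (of_int d) f) = (of_int_poly g :: complex poly)"
    unfolding d(2) by (simp add: map_poly_map_poly o_def)
  then have eq: "Polynomial.smult (of_int d) (map_poly of_rat f) = (of_int_poly g :: complex poly)"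
    by (simp add: of_rat_hom.map_poly_hom_smult)
  have "of_int d * poly (map_poly of_rat f) x = poly (of_int_poly g) x" for x :: complex
    unfolding eq[symmetric] by simp
  then show ?thesis using root_of_unity_conjugate[OF assms(1-3), of g] assms(4) d(1)
    by (metis mult_eq_0_iff of_int_eq_0_iff)
qed

subsection \<open>Block circulant matrices\<close>

lemma singular_mat_iff_det:
  fixes A :: "'a :: field mat"
  assumes "A \<in> carrier_mat n n"
  shows "singular_mat A \<longleftrightarrow> det A = 0"
proof -
  have "invertible_mat A \<longleftrightarrow> det A \<noteq> 0"
  proof
    assume "invertible_mat A"
    then obtain B where B: "A * B = 1\<^sub>m n" "B * A = 1\<^sub>m (dim_row B)"
      using assms unfolding invertible_mat_def inverts_mat_def by auto
    then have "B \<in> carrier_mat n n"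
      using assms by (metis carrier_matD(2) carrier_matI index_mult_mat(2,3) index_one_mat(2,3))
    then show "det A \<noteq> 0" using det_mult[OF assms, of B] B(1) by auto
  next
    assume "det A \<noteq> 0"
    then obtain B where "B \<in> carrier_mat n n" "A * B = 1\<^sub>m n" "B * A = 1\<^sub>m n"
      using det_non_zero_imp_unit[OF assms] by (auto simp: Units_def ring_mat_def)
    then show "invertible_mat A"
      using assms unfolding invertible_mat_def inverts_mat_def by auto
  qed
  then show ?thesis using assms by (auto simp: singular_mat_def)
qed

section \<open>Circulants and sums over roots of unity\<close>

text \<open>The row vector of the powers z^a is a left eigenvector of every circulant, with the
  first column's polynomial at z as eigenvalue. The substitution is a = (b + m) mod r.\<close>

lemma sum_circulant_times_power:
  fixes z :: "'a :: comm_ring_1" and c :: "nat \<Rightarrow> 'a"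
  assumes z: "z ^ r = 1" and b: "b < r"
  shows "(\<Sum>a<r. z ^ a * c (nat ((int a - int b) mod int r))) = z ^ b * (\<Sum>m<r. c m * z ^ m)"
proof -
  note pw = power_mod_root_of_unity[OF z]
  have "(\<Sum>m<r. z ^ b * (c m * z ^ m)) = (\<Sum>a<r. z ^ a * c (nat ((int a - int b) mod int r)))"
  proof (rule sum.reindex_bij_witness[where i = "\<lambda>a. nat ((int a - int b) mod int r)" and j = "\<lambda>m. (b + m) mod r"])
    fix m assume m: "m \<in> {..<r}"
    have "(int ((b + m) mod r) - int b) mod int r = int m"
      using m by (simp add: zmod_int mod_diff_left_eq)
    then show eq: "nat ((int ((b + m) mod r) - int b) mod int r) = m" by simp
    show "z ^ ((b + m) mod r) * c (nat ((int ((b + m) mod r) - int b) mod int r)) = z ^ b * (c m * z ^ m)"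
      unfolding eq by (simp add: pw power_add mult_ac)
  next
    fix a assume a: "a \<in> {..<r}"
    have "int ((b + nat ((int a - int b) mod int r)) mod r) = int a"
      using a by (simp add: zmod_int mod_add_right_eq)
    then show "(b + nat ((int a - int b) mod int r)) mod r = a" by simp
    show "nat ((int a - int b) mod int r) \<in> {..<r}"
      using b by (simp add: nat_less_iff)
  qed (use b in auto)
  then show ?thesis by (simp add: sum_distrib_left)
qed

lemma sum_lessThan_mult_blocks:
  fixes f :: "nat \<Rightarrow> 'a :: comm_monoid_add"
  shows "(\<Sum>l<r * t. f l) = (\<Sum>i<t. \<Sum>a<r. f (i * r + a))"
proof -
  have "(\<Sum>l<r * t. f l) = (\<Sum>i<t. sum f {i * r..<i * r + r})"
    by (simp add: sum.nat_group mult.commute)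
  also have "\<dots> = (\<Sum>i<t. \<Sum>a<r. f (i * r + a))"
  proof (rule sum.cong[OF refl])
    fix i
    show "sum f {i * r..<i * r + r} = (\<Sum>a<r. f (i * r + a))"
      using sum.shift_bounds_nat_ivl[of f 0 "i * r" r]
      by (simp add: atLeast0LessThan add.commute)
  qed
  finally show ?thesis .
qed

lemma block_index_less:
  fixes i a r t :: nat
  assumes "i < t" "a < r"
  shows "i * r + a < r * t"
proof -
  have "i * r + a < Suc i * r" using assms by simp
  also have "\<dots> \<le> t * r" using assms by (intro mult_le_mono1) simp
  finally show ?thesis by (simp add: mult.commute)
qed

text \<open>The sum is a nonzero polynomial of degree below r evaluated at z, so it cannot vanish at
  all r roots of unity.\<close>

lemma unity_roots_separate:
  fixes v :: "nat \<Rightarrow> complex"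
  assumes r: "r > 0" and b: "b < r" and v: "v b \<noteq> 0"
  shows "\<exists>z. z ^ r = 1 \<and> (\<Sum>a<r. z ^ a * v a) \<noteq> 0"
proof (rule ccontr)
  assume *: "\<not> ?thesis"
  define f where "f = (\<Sum>a<r. monom (v a) a)"
  have "coeff f b = v b" using b by (simp add: f_def coeff_sum)
  then have nz: "f \<noteq> 0" using v by auto
  have "degree f \<le> r - 1"
    unfolding f_def by (intro degree_sum_le order.trans[OF degree_monom_le]) auto
  moreover have "{z. z ^ r = 1} \<subseteq> {z. poly f z = 0}"
    using * by (auto simp: f_def poly_sum poly_monom mult.commute)
  then have "card {z :: complex. z ^ r = 1} \<le> card {z. poly f z = 0}"
    using poly_roots_finite[OF nz] by (intro card_mono)
  then have "r \<le> degree f"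
    using card_poly_roots_bound[OF nz] card_roots_unity_eq[OF r] by simp
  ultimately show False using r by simp
qed

interpretation of_rat_poly_hom: map_poly_comm_ring_hom "of_rat :: rat \<Rightarrow> complex" ..

section \<open>Kernel vectors of E and of its symbol\<close>

locale block_circulant =
  fixes r t :: nat and E :: "rat mat"
  assumes r: "r > 0"
    and E: "E \<in> carrier_mat (r * t) (r * t)"
    and circ: "\<And>i j. i < t \<Longrightarrow> j < t \<Longrightarrow> is_circulant r (mat_block r E i j)"
begin

lemma symbol_mat_carrier: "symbol_mat r t E z \<in> carrier_mat t t"
  by (simp add: symbol_mat_def)

lemma symbol_mat_index:
  assumes "i < t" "j < t"
  shows "symbol_mat r t E z $$ (i, j) = (\<Sum>m<r. of_rat (E $$ (i * r + m, j * r)) * z ^ m)"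
proof -
  have "first_col_poly r (mat_block r E i j) = (\<Sum>m<r. monom (E $$ (i * r + m, j * r)) m)"
    unfolding first_col_poly_def using r by (intro sum.cong) (simp_all add: mat_block_def)
  then show ?thesis
    using assms by (simp add: symbol_mat_def of_rat_poly_hom.hom_sum of_rat_hom.map_poly_hom_monom poly_sum poly_monom)
qed

text \<open>Eliminates the generator hidden in \<open>is_circulant\<close>: column 0 of the block
  recovers it.\<close>

lemma entry:
  assumes "i < t" "j < t" "a < r" "b < r"
  shows "E $$ (i * r + a, j * r + b) = E $$ (i * r + nat ((int a - int b) mod int r), j * r)"
proof -
  obtain c where c: "mat_block r E i j = circulant r c"
    using circ assms(1,2) unfolding is_circulant_def by blast
  have *: "E $$ (i * r + a', j * r + b') = c (nat ((int a' - int b') mod int r))" if "a' < r" "b' < r" for a' b'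
    using arg_cong[OF c, of "\<lambda>M. M $$ (a', b')"] that by (simp add: mat_block_def circulant_def)
  have lt: "nat ((int a - int b) mod int r) < r" using r by (simp add: nat_less_iff)
  show ?thesis using *[OF assms(3,4)] *[OF lt r] by simp
qed

text \<open>The intertwining relation between E and its symbol, on which both directions of the
  singularity criterion rest.\<close>

lemma sum_block:
  assumes "i < t" "j < t" "b < r" and z: "z ^ r = (1 :: complex)"
  shows "(\<Sum>a<r. z ^ a * of_rat (E $$ (i * r + a, j * r + b))) = z ^ b * symbol_mat r t E z $$ (i, j)"
proof -
  have "(\<Sum>a<r. z ^ a * of_rat (E $$ (i * r + a, j * r + b))) =
      (\<Sum>a<r. z ^ a * of_rat (E $$ (i * r + nat ((int a - int b) mod int r), j * r)))"
    by (intro sum.cong refl) (subst entry, use assms in auto)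
  also have "\<dots> = z ^ b * symbol_mat r t E z $$ (i, j)"
    using sum_circulant_times_power[OF z assms(3), of "\<lambda>m. of_rat (E $$ (i * r + m, j * r))"]
      symbol_mat_index[OF assms(1,2)] by simp
  finally show ?thesis .
qed

abbreviation EC :: "complex mat" where "EC \<equiv> map_mat of_rat E"

lemma EC_carrier: "EC \<in> carrier_mat (r * t) (r * t)"
  using E by simp

lemma EC_index:
  assumes "i < t" "j < t" "a < r" "b < r"
  shows "EC $$ (i * r + a, j * r + b) = of_rat (E $$ (i * r + a, j * r + b))"
  using E block_index_less assms by simp

text \<open>A left kernel vector w of the symbol lifts to a left kernel vector of E. Transposes
  appear because the kernel criterion for determinants concerns right kernels.\<close>

lemma symbol_singular_imp:
  assumes z: "z ^ r = 1" and "det (symbol_mat r t E z) = 0"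
  shows "det EC = 0"
proof -
  let ?S = "symbol_mat r t E z"
  have ST: "?S\<^sup>T \<in> carrier_mat t t" using symbol_mat_carrier by simp
  have "det (?S\<^sup>T) = 0" using assms(2) det_transpose[OF symbol_mat_carrier] by simp
  then obtain w where w: "w \<in> carrier_vec t" "w \<noteq> 0\<^sub>v t" "?S\<^sup>T *\<^sub>v w = 0\<^sub>v t"
    using det_0_iff_vec_prod_zero[OF ST] by blast
  have wS: "(\<Sum>i<t. ?S $$ (i, j) * w $ i) = 0" if "j < t" for j
    using arg_cong[OF w(3), of "\<lambda>v. v $ j"] that w(1) symbol_mat_carrier[of z]
    by (simp add: scalar_prod_def atLeast0LessThan)
  \<comment> \<open>The Kronecker product of w with the powers of z: block i is w_i times (1, z,
    ..., z^(r-1)).\<close>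
  define u where "u = vec (r * t) (\<lambda>l. z ^ (l mod r) * w $ (l div r))"
  have u: "u $ (i * r + a) = z ^ a * w $ i" if "i < t" "a < r" for i a
    using block_index_less[OF that] that by (simp add: u_def)
  have "EC\<^sup>T *\<^sub>v u = 0\<^sub>v (r * t)"
  proof (rule eq_vecI)
    fix l assume "l < dim_vec (0\<^sub>v (r * t) :: complex vec)"
    then have l: "l < r * t" by simp
    define j b where "j = l div r" and "b = l mod r"
    have jb: "j < t" "b < r" "l = j * r + b"
      using l r by (auto simp: j_def b_def less_mult_imp_div_less mult.commute)
    have "(EC\<^sup>T *\<^sub>v u) $ l = (\<Sum>x<r * t. EC $$ (x, l) * u $ x)"
      using l E by (simp add: scalar_prod_def atLeast0LessThan u_def)
    also have "\<dots> = (\<Sum>i<t. \<Sum>a<r. EC $$ (i * r + a, j * r + b) * u $ (i * r + a))"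
      unfolding sum_lessThan_mult_blocks jb(3) ..
    also have "\<dots> = (\<Sum>i<t. w $ i * (\<Sum>a<r. z ^ a * of_rat (E $$ (i * r + a, j * r + b))))"
      unfolding sum_distrib_left using jb
      by (intro sum.cong refl) (simp add: EC_index u)
    also have "\<dots> = (\<Sum>i<t. w $ i * (z ^ b * ?S $$ (i, j)))"
      using jb by (intro sum.cong refl) (simp add: sum_block z)
    also have "\<dots> = z ^ b * (\<Sum>i<t. ?S $$ (i, j) * w $ i)"
      by (simp add: sum_distrib_left mult_ac)
    finally show "(EC\<^sup>T *\<^sub>v u) $ l = 0\<^sub>v (r * t) $ l" using wS jb l by simp
  qed (use E in simp)
  moreover have "u \<noteq> 0\<^sub>v (r * t)"
  proof
    assume u0: "u = 0\<^sub>v (r * t)"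
    have "w $ i = 0" if "i < t" for i
      using u[OF that r] u0 block_index_less[OF that r] by simp
    then have "w = 0\<^sub>v t" using w(1) by (intro eq_vecI) auto
    then show False using w(2) by simp
  qed
  moreover have "u \<in> carrier_vec (r * t)" by (simp add: u_def)
  moreover have "EC\<^sup>T \<in> carrier_mat (r * t) (r * t)" using E by simp
  ultimately have "det (EC\<^sup>T) = 0" using det_0_iff_vec_prod_zero by blast
  then show ?thesis using det_transpose[OF EC_carrier] by simp
qed

text \<open>A right kernel vector of E is carried to one of the symbol by taking, blockwise, the
  Fourier sum at z.\<close>

lemma singular_imp_symbol:
  assumes "det EC = 0"
  shows "\<exists>z. z ^ r = 1 \<and> det (symbol_mat r t E z) = 0"
proof -
  obtain v where v: "v \<in> carrier_vec (r * t)" "v \<noteq> 0\<^sub>v (r * t)" "EC *\<^sub>v v = 0\<^sub>v (r * t)"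
    using assms det_0_iff_vec_prod_zero[OF EC_carrier] by blast
  then obtain l where l: "l < r * t" "v $ l \<noteq> 0"
    by (metis eq_vecI carrier_vecD index_zero_vec(1,2))
  define j0 b0 where "j0 = l div r" and "b0 = l mod r"
  have jb: "j0 < t" "b0 < r" "l = j0 * r + b0"
    using l r by (auto simp: j0_def b0_def less_mult_imp_div_less mult.commute)
  \<comment> \<open>Block j0 contains a nonzero entry of v; this choice of z keeps its Fourier sum,
    the entry j0 of w, nonzero.\<close>
  obtain z where z: "z ^ r = 1" and nz: "(\<Sum>b<r. z ^ b * v $ (j0 * r + b)) \<noteq> 0"
    using unity_roots_separate[OF r jb(2), of "\<lambda>b. v $ (j0 * r + b)"] l jb by blast
  let ?S = "symbol_mat r t E z"
  define w where "w = vec t (\<lambda>j. \<Sum>b<r. z ^ b * v $ (j * r + b))"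
  have row: "(\<Sum>j<t. \<Sum>b<r. of_rat (E $$ (i * r + a, j * r + b)) * v $ (j * r + b)) = 0"
    if "i < t" "a < r" for i a
  proof -
    have x: "i * r + a < r * t" using block_index_less that by blast
    have "0 = (EC *\<^sub>v v) $ (i * r + a)" using v(3) x by simp
    also have "\<dots> = (\<Sum>l<r * t. EC $$ (i * r + a, l) * v $ l)"
      using E x v(1) by (simp add: scalar_prod_def atLeast0LessThan)
    also have "\<dots> = (\<Sum>j<t. \<Sum>b<r. of_rat (E $$ (i * r + a, j * r + b)) * v $ (j * r + b))"
      unfolding sum_lessThan_mult_blocks using that by (intro sum.cong refl) (simp add: EC_index)
    finally show ?thesis by simp
  qed
  have "?S *\<^sub>v w = 0\<^sub>v t"
  proof (rule eq_vecI)
    fix i assume "i < dim_vec (0\<^sub>v t :: complex vec)"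
    then have i: "i < t" by simp
    have "(?S *\<^sub>v w) $ i = (\<Sum>j<t. ?S $$ (i, j) * (\<Sum>b<r. z ^ b * v $ (j * r + b)))"
      using i symbol_mat_carrier[of z] by (simp add: scalar_prod_def atLeast0LessThan w_def)
    also have "\<dots> = (\<Sum>j<t. \<Sum>b<r. v $ (j * r + b) * (\<Sum>a<r. z ^ a * of_rat (E $$ (i * r + a, j * r + b))))"
      using i by (intro sum.cong refl) (simp add: sum_distrib_left sum_block z mult_ac)
    \<comment> \<open>Moving the sum over a outwards leaves, for each a, the entry of E v in row i r
      + a, which is zero.\<close>
    also have "\<dots> = (\<Sum>j<t. \<Sum>a<r. \<Sum>b<r. z ^ a * (of_rat (E $$ (i * r + a, j * r + b)) * v $ (j * r + b)))"
      by (subst (2) sum.swap) (simp add: sum_distrib_left mult_ac)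
    also have "\<dots> = (\<Sum>a<r. z ^ a * (\<Sum>j<t. \<Sum>b<r. of_rat (E $$ (i * r + a, j * r + b)) * v $ (j * r + b)))"
      by (subst sum.swap) (simp add: sum_distrib_left)
    also have "\<dots> = 0" using i by (simp add: row)
    finally show "(?S *\<^sub>v w) $ i = 0\<^sub>v t $ i" using i by simp
  qed (simp add: symbol_mat_def)
  moreover have "w $ j0 \<noteq> 0" using nz jb by (simp add: w_def)
  then have "w \<noteq> 0\<^sub>v t" using jb by auto
  moreover have "w \<in> carrier_vec t" by (simp add: w_def)
  ultimately have "det ?S = 0"
    using det_0_iff_vec_prod_zero[OF symbol_mat_carrier] by blast
  then show ?thesis using z by blast
qed

text \<open>Evaluation at z is a ring homomorphism, so it commutes with the determinant. The witness
  is the determinant of the polynomial matrix \<open>?M\<close>, which does not involve z.\<close>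

lemma det_symbol_mat_poly:
  "\<exists>f :: rat poly. \<forall>z. det (symbol_mat r t E z) = poly (map_poly of_rat f) z"
proof (intro exI allI)
  fix z :: complex
  interpret ev: comm_ring_hom "\<lambda>p :: rat poly. poly (map_poly of_rat p) z"
    by unfold_locales (simp_all add: of_rat_poly_hom.hom_add of_rat_poly_hom.hom_mult)
  let ?M = "mat t t (\<lambda>(i, j). first_col_poly r (mat_block r E i j))"
  have "symbol_mat r t E z = map_mat (\<lambda>p. poly (map_poly of_rat p) z) ?M"
    by (intro eq_matI) (simp_all add: symbol_mat_def)
  then show "det (symbol_mat r t E z) = poly (map_poly of_rat (det ?M)) z"
    by (simp only: ev.hom_det)
qed

end

section \<open>Roots of unity in lowest terms and the conclusion\<close>

text \<open>The fraction n / r in the argument of z is reduced to lowest terms j / k; n = 0 gives j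
  = 0 and k = 1.\<close>

lemma root_of_unity_eq_power:
  fixes z :: complex
  assumes r: "r > 0" and z: "z ^ r = 1"
  shows "\<exists>k j. k > 0 \<and> k dvd r \<and> coprime j k \<and> z = exp (2 * complex_of_real pi * \<i> / of_nat k) ^ j"
proof -
  obtain n where n: "z = cis (2 * pi * real n / real r)"
    using bij_betw_roots_unity[OF r] z by (auto simp: bij_betw_def)
  define g where "g = gcd n r"
  have g: "g > 0" using r by (simp add: g_def)
  obtain j k where jk: "n = j * g" "r = k * g" "coprime j k"
    using gcd_coprime_exists[of n r] r unfolding g_def by (metis gcd_nat.neutr_eq_iff gr_implies_not0)
  have k: "k > 0" using jk(2) r by (cases k) auto
  have "exp (2 * complex_of_real pi * \<i> / of_nat k) = cis (2 * pi / real k)"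
    by (simp add: cis_conv_exp mult_ac)
  then have "exp (2 * complex_of_real pi * \<i> / of_nat k) ^ j = cis (real j * (2 * pi / real k))"
    by (simp add: Complex.DeMoivre)
  also have "real j * (2 * pi / real k) = 2 * pi * real n / real r"
    using jk k g by (simp add: field_simps)
  finally show ?thesis using k jk n by (metis dvd_triv_left)
qed

lemma exp_root_of_unity_power:
  assumes "k > 0"
  shows "exp (2 * complex_of_real pi * \<i> / of_nat k) ^ k = 1"
proof -
  have "exp (2 * complex_of_real pi * \<i> / of_nat k) ^ k = exp (of_nat k * (2 * complex_of_real pi * \<i> / of_nat k))"
    by (rule exp_of_nat_mult[symmetric])
  also have "\<dots> = exp (2 * complex_of_real pi * \<i>)" using assms by simp
  finally show ?thesis by (simp add: exp_eq_polar)
qed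

theorem theorem1:
  fixes r t :: nat and E :: "rat mat"
  assumes "r > 0" and "t > 0"
    and "E \<in> carrier_mat (r * t) (r * t)"
    and "\<And>i j. i < t \<Longrightarrow> j < t \<Longrightarrow> is_circulant r (mat_block r E i j)"
  shows "singular_mat E \<longleftrightarrow>
    (\<exists>k::nat. k > 0 \<and> k dvd r \<and>
      singular_mat (symbol_mat r t E (exp (2 * complex_of_real pi * \<i> / of_nat k))))"
proof -
  interpret block_circulant r t E
    using assms by unfold_locales
  \<comment> \<open>The determinant commutes with the embedding of the rationals, so singularity may
    be tested over the complex numbers.\<close>
  have "singular_mat E \<longleftrightarrow> det EC = 0"
    using singular_mat_iff_det[OF assms(3)] by (simp add: of_rat_hom.hom_det)
  also have "\<dots> \<longleftrightarrow> (\<exists>k::nat. k > 0 \<and> k dvd r \<and>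
      det (symbol_mat r t E (exp (2 * complex_of_real pi * \<i> / of_nat k))) = 0)" (is "_ \<longleftrightarrow> ?R")
  proof
    assume "det EC = 0"
    then obtain z where z: "z ^ r = 1" "det (symbol_mat r t E z) = 0"
      using singular_imp_symbol by blast
    obtain k j where k: "k > 0" "k dvd r" and j: "coprime j k"
        and zj: "z = exp (2 * complex_of_real pi * \<i> / of_nat k) ^ j"
      using root_of_unity_eq_power[OF assms(1) z(1)] by blast
    obtain f :: "rat poly" where f: "\<And>z. det (symbol_mat r t E z) = poly (map_poly of_rat f) z"
      using det_symbol_mat_poly by blast
    have "poly (map_poly of_rat f) (exp (2 * complex_of_real pi * \<i> / of_nat k)) = 0"
      using root_of_unity_conjugate_rat[OF k(1) exp_root_of_unity_power[OF k(1)] j] z(2)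
      unfolding f zj .
    then show ?R using k unfolding f by blast
  next
    assume ?R
    then obtain k where k: "k > 0" "k dvd r"
        and det: "det (symbol_mat r t E (exp (2 * complex_of_real pi * \<i> / of_nat k))) = 0" by blast
    have "exp (2 * complex_of_real pi * \<i> / of_nat k) ^ r = 1"
      using k exp_root_of_unity_power[OF k(1)] by (elim dvdE) (simp only: power_mult power_one)
    then show "det EC = 0" using det by (rule symbol_singular_imp)
  qed
  finally show ?thesis
    by (simp only: singular_mat_iff_det[OF symbol_mat_carrier])
qed

end
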